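(* Let $A,C>0$, let $U$ be an axially symmetric potential as in the context, and let $L\ge 0$ and $\Omega_3\in\mathbb R$ be given. Put $f(\rho)=U_3(\rho,0)$ and $g(\rho)=U_\rho(\rho,0)$. There exists a relative equilibrium $(\mathbf R_0,\mathbf P_0,\mathbf G_0,N)$ with $\frac{\partial U}{\partial\mathbf R}(\mathbf R_0)\ne\mathbf 0$, with total angular momentum of modulus $L$, and with $\boldsymbol\Omega_0=\mathbf I^{-1}\mathbf G_0=[0,0,\Omega_3]^T$ (a cylindrical precession) if and only if there exist $\varepsilon\in\{-1,1\}$ and $\rho>0$ (with $(\rho,0,0)\in D$) such that $g(\rho)\neq0$ and $$f(\rho)=0,\qquad (L+\varepsilon C\Omega_3)^2=\rho^3 g(\rho).$$ Given such $\rho,\varepsilon$, set $\beta=-\varepsilon(L+\varepsilon C\Omega_3)/\rho^2$, and let $R_1=\rho\cos\varphi$, $R_2=\rho\sin\varphi$ with $\varphi\in[0,2\pi]$ arbitrary; then such a relative equilibrium is given by $$\mathbf R_0=[R_1,R_2,0]^T,\quad \mathbf P_0=\beta[-R_2,R_1,0]^T,\quad \mathbf G_0=C[0,0,\Omega_3]^T,\quad N=\beta-\Omega_3.$$ Moreover, for these relative equilibria $\langle\mathbf G_0,\mathbf R_0\rangle=0$, $\langle\mathbf R_0,\mathbf Z\rangle=0$ and $\langle\mathbf P_0,\mathbf Z\rangle=0$, where $\mathbf Z=[0,0,1]^T$ (so the point mass and the mass centre of the body move in one plane, and the symmetry axis of the body is perpendicular to the plane of the relative orbit).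
   Context: Let $A,C>0$ and $\mathbf I=\operatorname{diag}(A,A,C)$. Let $D\subset\mathbb R^3\setminus\{\mathbf 0\}$ be an open set invariant under all rotations about the third coordinate axis, and let $U:D\to\mathbb R$ be a smooth function satisfying the axial symmetry condition $R_1\frac{\partial U}{\partial R_2}-R_2\frac{\partial U}{\partial R_1}=0$ on $D$. The (body-frame) equations of motion of a point mass and an axially symmetric rigid body are $$\dot{\mathbf R}=\mathbf R\times\boldsymbol\Omega+\mathbf P,\quad \dot{\mathbf P}=\mathbf P\times\boldsymbol\Omega-\frac{\partial U}{\partial\mathbf R},\quad \dot{\mathbf G}=\mathbf G\times\boldsymbol\Omega+\mathbf R\times\frac{\partial U}{\partial\mathbf R},\qquad \boldsymbol\Omega=\mathbf I^{-1}\mathbf G,$$ for $(\mathbf R,\mathbf P,\mathbf G)\in D\times\mathbb R^3\times\mathbb R^3$. Let $\mathbf A_3(\varphi)$ denote the matrix of rotation by angle $\varphi$ about the third axis, $\mathbf A_3(\varphi)=\begin{bmatrix}\cos\varphi&-\sin\varphi&0\\ \sin\varphi&\cos\varphi&0\\0&0&1\end{bmatrix}$. A relative equilibrium with data $(\mathbf R_0,\mathbf P_0,\mathbf G_0,N)$, where $\mathbf R_0\in D$, $\mathbf P_0,\mathbf G_0\in\mathbb R^3$ are constant vectors and $N\in\mathbb R$, is a solution of these equations of the form $\mathbf R(t)=\mathbf A_3(Nt)\mathbf R_0$, $\mathbf P(t)=\mathbf A_3(Nt)\mathbf P_0$, $\mathbf G(t)=\mathbf A_3(Nt)\mathbf G_0$.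 Its total angular momentum (body frame) is $\mathbf L=\mathbf R\times\mathbf P+\mathbf G$, whose modulus $L=\|\mathbf R_0\times\mathbf P_0+\mathbf G_0\|$ is constant. In cylindrical coordinates, with $\rho=\sqrt{R_1^2+R_2^2}$, $U$ depends only on $(\rho,R_3)$ and is written $U(\rho,R_3)$, meaning $U$ evaluated at $(\rho,0,R_3)$; $U_\rho=\partial U/\partial\rho$ and $U_3=\partial U/\partial R_3$. *)

theory Defs
  imports "HOL-Analysis.Analysis"
begin

text \<open>Iterated Frechet differentiability; on an open set \<open>S\<close> this is membership in \<open>C\<^sup>k\<close>.\<close>

primrec Ck_on :: "nat \<Rightarrow> 'a::real_normed_vector set \<Rightarrow> ('a \<Rightarrow> 'b::real_normed_vector) \<Rightarrow> bool" where
  "Ck_on 0 S f \<longleftrightarrow> continuous_on S f"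
| "Ck_on (Suc k) S f \<longleftrightarrow>
     (\<forall>x\<in>S. f differentiable (at x)) \<and> (\<forall>v. Ck_on k S (\<lambda>x. frechet_derivative f (at x) v))"

definition smooth_on :: "'a::real_normed_vector set \<Rightarrow> ('a \<Rightarrow> 'b::real_normed_vector) \<Rightarrow> bool" where
  "smooth_on S f \<longleftrightarrow> (\<forall>k. Ck_on k S f)"

definition grad :: "(real^'n \<Rightarrow> real) \<Rightarrow> real^'n \<Rightarrow> real^'n" where
  "grad U x = (\<chi> i. frechet_derivative U (at x) (axis i 1))"

definition rot3 :: "real \<Rightarrow> real^3^3" where
  "rot3 \<phi> = vector [vector [cos \<phi>, - sin \<phi>, 0],
                    vector [sin \<phi>, cos \<phi>, 0],
                    vector [0, 0, 1]]"

definition axially_symmetric_on :: "(real^3) set \<Rightarrow> (real^3 \<Rightarrow> real) \<Rightarrow> bool" where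
  "axially_symmetric_on D U \<longleftrightarrow> (\<forall>x\<in>D. x$1 * grad U x $ 2 - x$2 * grad U x $ 1 = 0)"

definition inertia :: "real \<Rightarrow> real \<Rightarrow> real^3^3" where
  "inertia A C = vector [vector [A, 0, 0], vector [0, A, 0], vector [0, 0, C]]"

definition ang_vel :: "real \<Rightarrow> real \<Rightarrow> real^3 \<Rightarrow> real^3" where
  "ang_vel A C G = matrix_inv (inertia A C) *v G"

definition is_motion ::
  "real \<Rightarrow> real \<Rightarrow> (real^3) set \<Rightarrow> (real^3 \<Rightarrow> real) \<Rightarrow>
   (real \<Rightarrow> real^3) \<Rightarrow> (real \<Rightarrow> real^3) \<Rightarrow> (real \<Rightarrow> real^3) \<Rightarrow> bool" where
  "is_motion A C D U R P G \<longleftrightarrow>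
     (\<forall>t. R t \<in> D \<and>
       (R has_vector_derivative (cross3 (R t) (ang_vel A C (G t)) + P t)) (at t) \<and>
       (P has_vector_derivative (cross3 (P t) (ang_vel A C (G t)) - grad U (R t))) (at t) \<and>
       (G has_vector_derivative
          (cross3 (G t) (ang_vel A C (G t)) + cross3 (R t) (grad U (R t)))) (at t))"

definition relative_equilibrium ::
  "real \<Rightarrow> real \<Rightarrow> (real^3) set \<Rightarrow> (real^3 \<Rightarrow> real) \<Rightarrow>
   real^3 \<Rightarrow> real^3 \<Rightarrow> real^3 \<Rightarrow> real \<Rightarrow> bool" where
  "relative_equilibrium A C D U R0 P0 G0 N \<longleftrightarrow>
     R0 \<in> D \<and>
     is_motion A C D U (\<lambda>t. rot3 (N * t) *v R0) (\<lambda>t. rot3 (N * t) *v P0) (\<lambda>t. rot3 (N * t) *v G0)"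

definition total_ang_mom :: "real^3 \<Rightarrow> real^3 \<Rightarrow> real^3 \<Rightarrow> real^3" where
  "total_ang_mom R P G = cross3 R P + G"

definition cylindrical_precession ::
  "real \<Rightarrow> real \<Rightarrow> (real^3) set \<Rightarrow> (real^3 \<Rightarrow> real) \<Rightarrow> real \<Rightarrow> real \<Rightarrow>
   real^3 \<Rightarrow> real^3 \<Rightarrow> real^3 \<Rightarrow> real \<Rightarrow> bool" where
  "cylindrical_precession A C D U L \<Omega>3 R0 P0 G0 N \<longleftrightarrow>
     relative_equilibrium A C D U R0 P0 G0 N \<and>
     grad U R0 \<noteq> 0 \<and>
     norm (total_ang_mom R0 P0 G0) = L \<and>
     ang_vel A C G0 = vector [0, 0, \<Omega>3]"

definition cyl :: "(real^3 \<Rightarrow> real) \<Rightarrow> real \<Rightarrow> real \<Rightarrow> real" where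
  "cyl U \<rho> z = U (vector [\<rho>, 0, z])"

definition U_rho :: "(real^3 \<Rightarrow> real) \<Rightarrow> real \<Rightarrow> real \<Rightarrow> real" where
  "U_rho U \<rho> z = deriv (\<lambda>r. cyl U r z) \<rho>"

definition U_3 :: "(real^3 \<Rightarrow> real) \<Rightarrow> real \<Rightarrow> real \<Rightarrow> real" where
  "U_3 U \<rho> z = deriv (\<lambda>s. cyl U \<rho> s) z"

definition precession_condition ::
  "real \<Rightarrow> (real^3) set \<Rightarrow> (real^3 \<Rightarrow> real) \<Rightarrow> real \<Rightarrow> real \<Rightarrow> real \<Rightarrow> real \<Rightarrow> bool" where
  "precession_condition C D U L \<Omega>3 \<epsilon> \<rho> \<longleftrightarrow>
     \<epsilon> \<in> {-1, 1} \<and> \<rho> > 0 \<and> vector [\<rho>, 0, 0] \<in> D \<and>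
     U_rho U \<rho> 0 \<noteq> 0 \<and> U_3 U \<rho> 0 = 0 \<and>
     (L + \<epsilon> * C * \<Omega>3)\<^sup>2 = \<rho>^3 * U_rho U \<rho> 0"

end

(* Axial symmetry makes U constant along rotation orbits in D, so its gradient is equivariant under
   rot3, and the equations of motion along a uniformly rotating solution reduce to algebraic
   equations at t = 0. With beta = N + Omega_3 and Z = (0,0,1) these say P0 = beta Z x R0,
   grad U R0 = beta^2 (R1,R2,0) and R0 x grad U R0 = 0; since the gradient is nonzero, the last
   forces R3 = 0. Then L = |beta rho^2 + C Omega_3|, where -epsilon is the sign inside the
   modulus, and the remaining conditions can be read off on the meridian at (rho,0,0). *)

theory Submission
  imports Defs
begin

lemmas vec3_simps = vec_eq_iff forall_3 vector_3 cross3_def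

section \<open>Algebra and calculus of rotations about the third axis\<close>

lemma rot3_vec:
  "rot3 \<phi> *v x = vector [cos \<phi> * x$1 - sin \<phi> * x$2, sin \<phi> * x$1 + cos \<phi> * x$2, x$3]"
  by (simp add: rot3_def vec3_simps matrix_vector_mult_def sum_3)

lemma rot3_add: "rot3 a *v (rot3 b *v x) = rot3 (a + b) *v x"
  by (simp add: rot3_vec vec3_simps cos_add sin_add algebra_simps)

lemma rot3_zero: "rot3 0 *v x = x"
  by (simp add: rot3_vec vec3_simps)

lemma inner_rot3_left: "(rot3 \<phi> *v u) \<bullet> w = u \<bullet> (rot3 (- \<phi>) *v w)"
  by (simp add: rot3_vec inner_vec_def sum_3 vector_3 algebra_simps)

lemma rot3_cross: "rot3 \<phi> *v cross3 x y = cross3 (rot3 \<phi> *v x) (rot3 \<phi> *v y)"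
proof -
  \<comment> \<open>Since \<phi> is fixed, this only replaces squared cosines, in the nested shape
    that appears after normalising products.\<close>
  have *: "cos \<phi> * (cos \<phi> * a) = a - sin \<phi> * (sin \<phi> * a)" for a
    using sin_cos_squared_add[of \<phi>] by algebra
  show ?thesis
    by (simp add: rot3_vec vec3_simps algebra_simps *)
qed

text \<open>The cross product with the axis vector is the infinitesimal generator of the rotations.
  Keeping it inside the rotation lets equations at time \<open>t\<close> be compared with those at
  time 0.\<close>

lemma rot3_has_vector_derivative:
  "((\<lambda>t. rot3 (N * t) *v x) has_vector_derivative
     N *\<^sub>R (rot3 (N * t) *v cross3 (vector [0, 0, 1]) x)) (at t)"
proof -
  have "rot3 (N * t) *v x = cos (N * t) *\<^sub>R vector [x$1, x$2, 0]
      + sin (N * t) *\<^sub>R vector [- x$2, x$1, 0] + vector [0, 0, x$3]" for t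
    by (simp add: rot3_vec vec3_simps)
  moreover have "((\<lambda>t. cos (N * t) *\<^sub>R (vector [x$1, x$2, 0] :: real^3)
      + sin (N * t) *\<^sub>R vector [- x$2, x$1, 0] + vector [0, 0, x$3]) has_vector_derivative
      N *\<^sub>R (rot3 (N * t) *v cross3 (vector [0, 0, 1]) x)) (at t)"
    by (auto intro!: derivative_eq_intros simp: rot3_vec vec3_simps algebra_simps)
  ultimately show ?thesis by simp
qed

section \<open>Inverse inertia matrix and the gradient as a derivative\<close>

lemma ang_vel_eq:
  assumes "A \<noteq> 0" "C \<noteq> 0"
  shows "ang_vel A C G = vector [G$1 / A, G$2 / A, G$3 / C]"
proof -
  let ?J = "vector [vector [1/A, 0, 0], vector [0, 1/A, 0], vector [0, 0, 1/C]] :: real^3^3"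
  have J: "inertia A C ** ?J = mat 1" "?J ** inertia A C = mat 1"
    using assms
    by (auto simp: inertia_def vec_eq_iff forall_3 vector_3 sum_3 matrix_matrix_mult_def mat_def)
  \<comment> \<open>\<open>matrix_inv\<close> is a Hilbert choice, so uniqueness of the left inverse
    is what identifies it with \<open>?J\<close>.\<close>
  have "K = ?J" if "K ** inertia A C = mat 1" for K
  proof -
    have "K = K ** (inertia A C ** ?J)" by (simp only: J matrix_mul_rid)
    also have "\<dots> = ?J" by (simp only: matrix_mul_assoc that matrix_mul_lid)
    finally show ?thesis .
  qed
  with J have "matrix_inv (inertia A C) = ?J"
    unfolding matrix_inv_def by (intro some_equality) blast+
  then show ?thesis
    by (simp add: ang_vel_def vec3_simps matrix_vector_mult_def sum_3)
qed

lemma has_derivative_grad: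
  fixes U :: "real^'n \<Rightarrow> real"
  assumes "U differentiable (at x)"
  shows "(U has_derivative (\<lambda>v. grad U x \<bullet> v)) (at x)"
proof -
  let ?F = "frechet_derivative U (at x)"
  have d: "(U has_derivative ?F) (at x)"
    using assms frechet_derivative_works by blast
  then interpret linear ?F
    by (rule has_derivative_linear)
  have "?F v = grad U x \<bullet> v" for v
  proof -
    have "?F v = ?F (\<Sum>i\<in>UNIV. v$i *\<^sub>R axis i 1)"
      by (simp add: basis_expansion scalar_mult_eq_scaleR[symmetric])
    also have "\<dots> = grad U x \<bullet> v"
      by (simp add: sum scale grad_def inner_vec_def mult.commute)
    finally show ?thesis .
  qed
  then have "?F = (\<lambda>v. grad U x \<bullet> v)" by blast
  with d show ?thesis by simp
qed

section \<open>Potentials with axial symmetry and their gradients\<close>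

locale axial_potential =
  fixes D :: "(real^3) set" and U :: "real^3 \<Rightarrow> real"
  assumes open_D: "open D"
    and rot3_D: "\<And>\<phi> x. x \<in> D \<Longrightarrow> rot3 \<phi> *v x \<in> D"
    and smooth: "smooth_on D U"
    and axial: "axially_symmetric_on D U"
begin

lemma U_deriv:
  assumes "x \<in> D"
  shows "(U has_derivative (\<lambda>v. grad U x \<bullet> v)) (at x)"
proof -
  have "Ck_on (Suc 0) D U" using smooth unfolding smooth_on_def by blast
  then show ?thesis using assms by (intro has_derivative_grad) simp
qed

text \<open>The orbit stays in \<open>D\<close>, and the derivative of \<open>U\<close> along it is
  exactly the expression that the symmetry condition sets to zero.\<close>

lemma U_rot3:
  assumes "x \<in> D"
  shows "U (rot3 \<phi> *v x) = U x"
proof -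
  have "((\<lambda>t. U (rot3 t *v x)) has_real_derivative 0) (at t)" for t
  proof -
    let ?y = "rot3 t *v x"
    have y: "?y \<in> D" using assms rot3_D by blast
    have "((\<lambda>t. rot3 t *v x) has_derivative
        (\<lambda>h. h *\<^sub>R (rot3 t *v cross3 (vector [0, 0, 1]) x))) (at t)"
      using rot3_has_vector_derivative[of 1 x t] by (simp add: has_vector_derivative_def)
    from has_derivative_compose[OF this U_deriv[OF y]]
    have "((\<lambda>t. U (rot3 t *v x)) has_derivative
        (\<lambda>h. grad U ?y \<bullet> (h *\<^sub>R (rot3 t *v cross3 (vector [0, 0, 1]) x)))) (at t)" .
    moreover have "grad U ?y \<bullet> (rot3 t *v cross3 (vector [0, 0, 1]) x)
        = ?y$1 * grad U ?y $ 2 - ?y$2 * grad U ?y $ 1"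
      by (simp add: rot3_vec inner_vec_def sum_3 vector_3 cross3_def algebra_simps)
    moreover have "?y$1 * grad U ?y $ 2 - ?y$2 * grad U ?y $ 1 = 0"
      using axial y unfolding axially_symmetric_on_def by blast
    ultimately show ?thesis
      by (simp add: has_field_derivative_def lambda_zero)
  qed
  then have "U (rot3 \<phi> *v x) = U (rot3 0 *v x)"
    using DERIV_isconst_all by blast
  then show ?thesis by (simp add: rot3_zero)
qed

text \<open>Differentiate the invariance of \<open>U\<close> by the chain rule; the transpose of a
  rotation is its inverse.\<close>

lemma grad_rot3:
  assumes x: "x \<in> D"
  shows "grad U (rot3 \<phi> *v x) = rot3 \<phi> *v grad U x"
proof -
  have "((\<lambda>y. rot3 \<phi> *v y) has_derivative (\<lambda>v. rot3 \<phi> *v v)) (at x)"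
    by (rule bounded_linear.has_derivative[OF matrix_vector_mul_bounded_linear]) simp
  from has_derivative_compose[OF this U_deriv[OF rot3_D[OF x]]]
  have "((\<lambda>y. U (rot3 \<phi> *v y)) has_derivative
      (\<lambda>v. grad U (rot3 \<phi> *v x) \<bullet> (rot3 \<phi> *v v))) (at x)" .
  \<comment> \<open>Invariance is known on \<open>D\<close> only; openness of \<open>D\<close> makes
    it local information at \<open>x\<close>, enough to transfer the derivative.\<close>
  then have "(U has_derivative (\<lambda>v. grad U (rot3 \<phi> *v x) \<bullet> (rot3 \<phi> *v v))) (at x)"
    by (rule has_derivative_transform_within_open[OF _ open_D x]) (simp add: U_rot3)
  from has_derivative_unique[OF this U_deriv[OF x]]
  have *: "grad U (rot3 \<phi> *v x) \<bullet> (rot3 \<phi> *v v) = grad U x \<bullet> v" for v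
    by meson
  have "grad U (rot3 \<phi> *v x) \<bullet> w = (rot3 \<phi> *v grad U x) \<bullet> w" for w
    using *[of "rot3 (- \<phi>) *v w"] by (simp add: inner_rot3_left rot3_add rot3_zero)
  then show ?thesis
    by (metis vector_eq_rdot)
qed

text \<open>Where the second coordinate vanishes, the cylindrical partials are derivatives along the
  first and third axes, and the symmetry condition reduces to \<rho> times the second gradient
  component being 0.\<close>

lemma grad_meridian:
  assumes "vector [\<rho>, 0, z] \<in> D" and "\<rho> \<noteq> 0"
  shows "grad U (vector [\<rho>, 0, z]) = vector [U_rho U \<rho> z, 0, U_3 U \<rho> z]"
proof -
  let ?x = "vector [\<rho>, 0, z] :: real^3"
  have line: "((\<lambda>r. a + r *\<^sub>R b) has_derivative (\<lambda>h. h *\<^sub>R b)) (at s)" for a b :: "real^3" and s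
    by (auto intro!: derivative_eq_intros)
  have 1: "(\<lambda>r. vector [r, 0, z] :: real^3) = (\<lambda>r. vector [0, 0, z] + r *\<^sub>R vector [1, 0, 0])"
    and 3: "(\<lambda>r. vector [\<rho>, 0, r] :: real^3) = (\<lambda>r. vector [\<rho>, 0, 0] + r *\<^sub>R vector [0, 0, 1])"
    by (auto simp: vec3_simps)
  have "((\<lambda>r. vector [r, 0, z] :: real^3) has_derivative (\<lambda>h. h *\<^sub>R vector [1, 0, 0])) (at \<rho>)"
    unfolding 1 by (rule line)
  from has_derivative_compose[OF this U_deriv[OF assms(1)]]
  have "((\<lambda>r. cyl U r z) has_real_derivative grad U ?x $ 1) (at \<rho>)"
    by (simp add: cyl_def has_field_derivative_def inner_vec_def sum_3 vector_3 mult.commute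
        mult_commute_abs)
  moreover
  have "((\<lambda>r. vector [\<rho>, 0, r] :: real^3) has_derivative (\<lambda>h. h *\<^sub>R vector [0, 0, 1])) (at z)"
    unfolding 3 by (rule line)
  from has_derivative_compose[OF this U_deriv[OF assms(1)]]
  have "((\<lambda>r. cyl U \<rho> r) has_real_derivative grad U ?x $ 3) (at z)"
    by (simp add: cyl_def has_field_derivative_def inner_vec_def sum_3 vector_3 mult.commute
        mult_commute_abs)
  moreover have "grad U ?x $ 2 = 0"
    using axial assms unfolding axially_symmetric_on_def by (force simp: vector_3)
  ultimately show ?thesis
    by (simp add: U_rho_def U_3_def DERIV_imp_deriv vec3_simps)
qed

section \<open>Cylindrical precessions as solutions of algebraic equations\<close>

lemma cylindrical_precession_iff:
  assumes "A > 0" "C > 0"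
  shows "cylindrical_precession A C D U L \<Omega>3 R0 P0 G0 N \<longleftrightarrow>
     R0 \<in> D \<and> R0$3 = 0 \<and> G0 = vector [0, 0, C * \<Omega>3] \<and>
     P0 = (N + \<Omega>3) *\<^sub>R vector [- R0$2, R0$1, 0] \<and>
     grad U R0 = (N + \<Omega>3)\<^sup>2 *\<^sub>R R0 \<and> grad U R0 \<noteq> 0 \<and>
     \<bar>(N + \<Omega>3) * ((R0$1)\<^sup>2 + (R0$2)\<^sup>2) + C * \<Omega>3\<bar> = L"
    (is "?lhs \<longleftrightarrow> ?rhs")
proof -
  let ?Z = "vector [0, 0, 1] :: real^3"
  let ?\<Omega> = "vector [0, 0, \<Omega>3] :: real^3"
  have omega: "ang_vel A C G0 = ?\<Omega> \<longleftrightarrow> G0 = vector [0, 0, C * \<Omega>3]"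
    using assms by (auto simp: ang_vel_eq vec3_simps field_simps)
  \<comment> \<open>Both vectors lie on the axis and are fixed by rotations. The right-hand side is
    still written as a rotated vector so that the rotation can later be factored out.\<close>
  have omega_t: "ang_vel A C (rot3 a *v G0) = rot3 a *v ?\<Omega>" if "G0 = vector [0, 0, C * \<Omega>3]" for a
    using that assms by (simp add: ang_vel_eq rot3_vec vec3_simps)
  have norm_z: "norm (vector [0, 0, c] :: real^3) = \<bar>c\<bar>" for c
    by (simp add: norm_eq_sqrt_inner inner_vec_def sum_3 vector_3)
  show ?thesis
  proof
    assume l: ?lhs
    then have G0: "G0 = vector [0, 0, C * \<Omega>3]" and R0: "R0 \<in> D" and nz: "grad U R0 \<noteq> 0"
      and L: "norm (cross3 R0 P0 + G0) = L"
      and m: "is_motion A C D U (\<lambda>t. rot3 (N * t) *v R0) (\<lambda>t. rot3 (N * t) *v P0)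
               (\<lambda>t. rot3 (N * t) *v G0)"
      by (auto simp only: cylindrical_precession_def relative_equilibrium_def omega
          total_ang_mom_def)
    have d0: "((\<lambda>t. rot3 (N * t) *v x) has_vector_derivative N *\<^sub>R cross3 ?Z x) (at 0)" for x
      using rot3_has_vector_derivative[of N x 0] by (simp add: rot3_zero)
    have m0: "((\<lambda>t. rot3 (N * t) *v R0) has_vector_derivative cross3 R0 ?\<Omega> + P0) (at 0)"
      "((\<lambda>t. rot3 (N * t) *v P0) has_vector_derivative cross3 P0 ?\<Omega> - grad U R0) (at 0)"
      "((\<lambda>t. rot3 (N * t) *v G0) has_vector_derivative
         cross3 G0 ?\<Omega> + cross3 R0 (grad U R0)) (at 0)"
      using m[unfolded is_motion_def, rule_format, of 0]
      by (simp_all add: omega_t[OF G0, of 0, unfolded rot3_zero] rot3_zero)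
    \<comment> \<open>At time 0 the velocity is known twice, from the generator and from the
      equations of motion; derivatives are unique.\<close>
    have e1: "N *\<^sub>R cross3 ?Z R0 = cross3 R0 ?\<Omega> + P0"
      and e2: "N *\<^sub>R cross3 ?Z P0 = cross3 P0 ?\<Omega> - grad U R0"
      and e3: "N *\<^sub>R cross3 ?Z G0 = cross3 G0 ?\<Omega> + cross3 R0 (grad U R0)"
      using vector_derivative_unique_at[OF d0] m0 by blast+
    have P0: "P0 = (N + \<Omega>3) *\<^sub>R vector [- R0$2, R0$1, 0]"
      using e1 by (auto simp: vec3_simps algebra_simps)
    have gr: "grad U R0 = (N + \<Omega>3)\<^sup>2 *\<^sub>R vector [R0$1, R0$2, 0]"
      using e2 unfolding P0 by (auto simp: vec3_simps algebra_simps power2_eq_square)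
    \<comment> \<open>The vectors \<open>G0\<close> and \<open>?\<Omega>\<close> are axial, so
      \<open>e3\<close> says \<open>cross3 R0 (grad U R0) = 0\<close>. The cross product is
      \<open>R0$3\<close> times a quarter turn of the horizontal, nonzero gradient.\<close>
    have "R0$3 = 0"
      using e3 nz unfolding gr G0 by (auto simp: vec3_simps)
    moreover from this have "vector [R0$1, R0$2, 0] = R0"
      by (simp add: vec3_simps)
    moreover have "cross3 R0 P0 + G0
        = vector [0, 0, (N + \<Omega>3) * ((R0$1)\<^sup>2 + (R0$2)\<^sup>2) + C * \<Omega>3]"
      using \<open>R0$3 = 0\<close> unfolding P0 G0
      by (simp add: vec3_simps algebra_simps power2_eq_square)
    ultimately show ?rhs
      using R0 G0 P0 gr nz L by (simp add: norm_z)
  next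
    assume r: ?rhs
    then have R0: "R0 \<in> D" and R3: "R0$3 = 0" and G0: "G0 = vector [0, 0, C * \<Omega>3]"
      and P0: "P0 = (N + \<Omega>3) *\<^sub>R vector [- R0$2, R0$1, 0]"
      and gr: "grad U R0 = (N + \<Omega>3)\<^sup>2 *\<^sub>R R0" by auto
    have mom: "cross3 R0 P0 + G0
        = vector [0, 0, (N + \<Omega>3) * ((R0$1)\<^sup>2 + (R0$2)\<^sup>2) + C * \<Omega>3]"
      using R3 unfolding P0 G0
      by (simp add: vec3_simps algebra_simps power2_eq_square)
    have e1: "N *\<^sub>R cross3 ?Z R0 = cross3 R0 ?\<Omega> + P0"
      and e2: "N *\<^sub>R cross3 ?Z P0 = cross3 P0 ?\<Omega> - grad U R0"
      and e3: "N *\<^sub>R cross3 ?Z G0 = cross3 G0 ?\<Omega> + cross3 R0 (grad U R0)"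
      using R3 unfolding gr P0 G0
      by (simp_all add: vec3_simps algebra_simps power2_eq_square)
    have "is_motion A C D U (\<lambda>t. rot3 (N * t) *v R0) (\<lambda>t. rot3 (N * t) *v P0)
               (\<lambda>t. rot3 (N * t) *v G0)"
      \<comment> \<open>Each right-hand side at time \<open>t\<close> is the rotated right-hand side
        at time 0, which \<open>e1\<close>, \<open>e2\<close> and \<open>e3\<close> turn into the
        rotated generator, that is, the derivative.\<close>
      unfolding is_motion_def omega_t[OF G0] grad_rot3[OF R0] rot3_cross[symmetric]
        matrix_vector_right_distrib[symmetric] matrix_vector_mult_diff_distrib[symmetric]
        e1[symmetric] e2[symmetric] e3[symmetric]
      using R0 rot3_D rot3_has_vector_derivative
      by (auto simp: matrix_vector_mult_scaleR)
    moreover have "norm (cross3 R0 P0 + G0) = L"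
      using r unfolding mom norm_z by blast
    moreover have "ang_vel A C G0 = ?\<Omega>"
      using G0 omega by blast
    ultimately show ?lhs
      using r unfolding cylindrical_precession_def relative_equilibrium_def total_ang_mom_def
      by blast
  qed
qed

text \<open>The value of \<beta> is chosen so that the axial momentum
  \<open>\<beta> * \<rho>\<^sup>2 + C * \<Omega>3\<close> equals \<open>- \<epsilon> * L\<close>.
  The gradient equation is checked at the meridian point and carried to angle \<phi> by
  equivariance.\<close>

lemma precession_condition_imp:
  assumes "A > 0" "C > 0" "L \<ge> 0" and pc: "precession_condition C D U L \<Omega>3 \<epsilon> \<rho>"
    and \<beta>: "\<beta> = - \<epsilon> * (L + \<epsilon> * C * \<Omega>3) / \<rho>\<^sup>2"
  shows "cylindrical_precession A C D U L \<Omega>3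
      (vector [\<rho> * cos \<phi>, \<rho> * sin \<phi>, 0])
      (\<beta> *\<^sub>R vector [- (\<rho> * sin \<phi>), \<rho> * cos \<phi>, 0])
      (C *\<^sub>R vector [0, 0, \<Omega>3]) (\<beta> - \<Omega>3)"
proof -
  let ?x = "vector [\<rho>, 0, 0] :: real^3"
  let ?y = "vector [\<rho> * cos \<phi>, \<rho> * sin \<phi>, 0] :: real^3"
  from pc have \<epsilon>: "\<epsilon>\<^sup>2 = 1" and \<rho>: "\<rho> > 0" and x: "?x \<in> D"
    and g: "U_rho U \<rho> 0 \<noteq> 0" "U_3 U \<rho> 0 = 0"
    and eq: "(L + \<epsilon> * C * \<Omega>3)\<^sup>2 = \<rho>^3 * U_rho U \<rho> 0"
    by (auto simp: precession_condition_def)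
  have y: "?y = rot3 \<phi> *v ?x"
    by (simp add: rot3_vec vec3_simps)
  \<comment> \<open>Squaring removes \<epsilon>; cancelling the cube of \<rho> then gives the
    balance of centripetal and radial force.\<close>
  have "\<beta>\<^sup>2 * \<rho>^4 = (L + \<epsilon> * C * \<Omega>3)\<^sup>2"
    using \<rho> \<epsilon> by (simp add: \<beta> power_divide power_mult_distrib)
  then have "\<beta>\<^sup>2 * \<rho> = U_rho U \<rho> 0"
    using eq \<rho> by (simp add: power_numeral_reduce)
  then have gx: "grad U ?x = \<beta>\<^sup>2 *\<^sub>R ?x"
    using grad_meridian[OF x] \<rho> g by (simp add: vec3_simps)
  then have gy: "grad U ?y = \<beta>\<^sup>2 *\<^sub>R ?y"
    by (simp add: y grad_rot3[OF x] matrix_vector_mult_scaleR)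
  have "\<beta> \<noteq> 0" using \<open>\<beta>\<^sup>2 * \<rho> = U_rho U \<rho> 0\<close> g by auto
  moreover have "(?y$1)\<^sup>2 + (?y$2)\<^sup>2 = \<rho>\<^sup>2"
    by (simp add: vector_3 power_mult_distrib flip: distrib_left)
  moreover from this have "?y \<noteq> 0" using \<rho> by (force simp del: vector_3)
  moreover have "\<beta> * \<rho>\<^sup>2 = - \<epsilon> * L - C * \<Omega>3"
  proof -
    have "\<beta> * \<rho>\<^sup>2 = - \<epsilon> * (L + \<epsilon> * C * \<Omega>3)" using \<rho> by (simp add: \<beta>)
    also have "\<dots> = - \<epsilon> * L - \<epsilon>\<^sup>2 * C * \<Omega>3" by (simp add: algebra_simps power2_eq_square)
    finally show ?thesis by (simp add: \<epsilon>)
  qed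
  moreover have "\<bar>\<epsilon> * L\<bar> = L"
    using \<epsilon> \<open>L \<ge> 0\<close> by (auto simp: abs_mult power2_eq_1_iff)
  moreover have "?y \<in> D" using y x rot3_D by simp
  ultimately show ?thesis
    using gy unfolding cylindrical_precession_iff[OF assms(1,2)]
    by (simp add: vector_3) (simp add: vec3_simps)
qed

text \<open>Rotate the horizontal vector \<open>R0\<close> back to the meridian, where the gradient
  equation gives the values of \<open>U_rho\<close> and \<open>U_3\<close>.\<close>

lemma precession_imp_condition:
  assumes "A > 0" "C > 0" and cp: "cylindrical_precession A C D U L \<Omega>3 R0 P0 G0 N"
  shows "\<exists>\<epsilon> \<rho>. precession_condition C D U L \<Omega>3 \<epsilon> \<rho>"
proof -
  define \<beta> where "\<beta> = N + \<Omega>3"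
  define \<rho> where "\<rho> = sqrt ((R0$1)\<^sup>2 + (R0$2)\<^sup>2)"
  let ?x = "vector [\<rho>, 0, 0] :: real^3"
  have R0: "R0 \<in> D" "R0$3 = 0" and gr: "grad U R0 = \<beta>\<^sup>2 *\<^sub>R R0" "grad U R0 \<noteq> 0"
    and L: "\<bar>\<beta> * \<rho>\<^sup>2 + C * \<Omega>3\<bar> = L"
    using cp unfolding cylindrical_precession_iff[OF assms(1,2)] \<beta>_def \<rho>_def by auto
  have "R0 \<noteq> 0" and \<beta>: "\<beta> \<noteq> 0" using gr by auto
  \<comment> \<open>A nonzero gradient parallel to \<open>R0\<close> excludes \<open>R0 = 0\<close>,
    and \<open>R0\<close> is horizontal.\<close>
  then have "\<rho> > 0" using R0(2)
    by (auto simp: \<rho>_def vec3_simps sum_power2_gt_zero_iff)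
  obtain \<phi> where "R0$1 = \<rho> * cos \<phi>" "R0$2 = \<rho> * sin \<phi>"
  proof -
    have "(R0$1 / \<rho>)\<^sup>2 + (R0$2 / \<rho>)\<^sup>2 = 1"
      using \<open>\<rho> > 0\<close> by (simp add: \<rho>_def power_divide sum_power2_gt_zero_iff
          flip: add_divide_distrib)
    with that \<open>\<rho> > 0\<close> show thesis
      by (elim sincos_total_2pi) (auto simp: field_simps)
  qed
  then have "R0 = rot3 \<phi> *v ?x"
    using R0(2) by (simp add: rot3_vec vec3_simps)
  then have x: "?x = rot3 (- \<phi>) *v R0"
    by (simp add: rot3_add rot3_zero)
  have xD: "?x \<in> D" using x R0 rot3_D by simp
  have "grad U ?x = \<beta>\<^sup>2 *\<^sub>R ?x"
    using grad_rot3[OF R0(1), of "- \<phi>"] x gr(1) by (simp add: matrix_vector_mult_scaleR)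
  then have g: "U_rho U \<rho> 0 = \<beta>\<^sup>2 * \<rho>" "U_3 U \<rho> 0 = 0"
    using grad_meridian[OF xD] \<open>\<rho> > 0\<close> by (auto simp: vec3_simps)
  \<comment> \<open>Opposite to the sign of the axial momentum, so that this momentum equals
    \<open>- \<epsilon> * L\<close>. If it vanishes, then \<open>L = 0\<close> and either sign would
    do.\<close>
  define \<epsilon> :: real where "\<epsilon> = (if \<beta> * \<rho>\<^sup>2 + C * \<Omega>3 \<ge> 0 then - 1 else 1)"
  have "L + \<epsilon> * C * \<Omega>3 = - \<epsilon> * (\<beta> * \<rho>\<^sup>2)"
    using L by (auto simp: \<epsilon>_def)
  then have "(L + \<epsilon> * C * \<Omega>3)\<^sup>2 = \<rho>^3 * U_rho U \<rho> 0"
    by (simp add: g \<epsilon>_def power_mult_distrib power_numeral_reduce)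
  then have "precession_condition C D U L \<Omega>3 \<epsilon> \<rho>"
    using g \<beta> \<open>\<rho> > 0\<close> xD by (simp add: precession_condition_def \<epsilon>_def)
  then show ?thesis by blast
qed

end

section \<open>Equivalence, explicit family and orthogonality relations\<close>

theorem mainTheorem2:
  fixes A C L \<Omega>3 :: real and D :: "(real^3) set" and U :: "real^3 \<Rightarrow> real"
  assumes "A > 0" and "C > 0"
    and "open D" and "0 \<notin> D"
    and "\<And>\<phi> x. x \<in> D \<Longrightarrow> rot3 \<phi> *v x \<in> D"
    and "smooth_on D U" and "axially_symmetric_on D U"
    and "L \<ge> 0"
  shows
    "((\<exists>R0 P0 G0 N. cylindrical_precession A C D U L \<Omega>3 R0 P0 G0 N) \<longleftrightarrow>
        (\<exists>\<epsilon> \<rho>. precession_condition C D U L \<Omega>3 \<epsilon> \<rho>)) \<and>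
     (\<forall>\<epsilon> \<rho> \<phi>. precession_condition C D U L \<Omega>3 \<epsilon> \<rho> \<longrightarrow> \<phi> \<in> {0..2 * pi} \<longrightarrow>
        (let \<beta> = - \<epsilon> * (L + \<epsilon> * C * \<Omega>3) / \<rho>\<^sup>2;
             R1 = \<rho> * cos \<phi>;
             R2 = \<rho> * sin \<phi>
         in cylindrical_precession A C D U L \<Omega>3
              (vector [R1, R2, 0])
              (\<beta> *\<^sub>R vector [- R2, R1, 0])
              (C *\<^sub>R vector [0, 0, \<Omega>3])
              (\<beta> - \<Omega>3))) \<and>
     (\<forall>R0 P0 G0 N. cylindrical_precession A C D U L \<Omega>3 R0 P0 G0 N \<longrightarrow>
        G0 \<bullet> R0 = 0 \<and> R0 \<bullet> vector [0, 0, 1] = 0 \<and> P0 \<bullet> vector [0, 0, 1] = 0)"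
proof -
  interpret axial_potential D U
    using assms by unfold_locales auto
  note imp = precession_condition_imp[OF assms(1,2,8) _ refl]
  show ?thesis
  proof (intro conjI iffI allI impI)
    show "\<exists>\<epsilon> \<rho>. precession_condition C D U L \<Omega>3 \<epsilon> \<rho>"
      if "\<exists>R0 P0 G0 N. cylindrical_precession A C D U L \<Omega>3 R0 P0 G0 N"
      using that precession_imp_condition[OF assms(1,2)] by blast
    show "let \<beta> = - \<epsilon> * (L + \<epsilon> * C * \<Omega>3) / \<rho>\<^sup>2; R1 = \<rho> * cos \<phi>; R2 = \<rho> * sin \<phi>
         in cylindrical_precession A C D U L \<Omega>3 (vector [R1, R2, 0])
              (\<beta> *\<^sub>R vector [- R2, R1, 0]) (C *\<^sub>R vector [0, 0, \<Omega>3]) (\<beta> - \<Omega>3)"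
      if "precession_condition C D U L \<Omega>3 \<epsilon> \<rho>" for \<epsilon> \<rho> \<phi>
      using imp[OF that] unfolding Let_def .
    show "\<exists>R0 P0 G0 N. cylindrical_precession A C D U L \<Omega>3 R0 P0 G0 N"
      if "\<exists>\<epsilon> \<rho>. precession_condition C D U L \<Omega>3 \<epsilon> \<rho>"
      using that imp by blast
  \<comment> \<open>Left over are the orthogonality relations: by the algebraic form
    \<open>G0\<close> is axial, while \<open>R0\<close> and \<open>P0\<close> are
    horizontal.\<close>
  qed (simp_all add: cylindrical_precession_iff[OF assms(1,2)]
         inner_vec_def sum_3 vector_3)
qed

end
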